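(* For every unsatisfiable CNF formula $F$, every tree-like resolution refutation of $F\circ\mathrm{OR}$ has size $\exp(\Omega(\mathrm{DT}_1(\mathrm{Search}(F))))$; that is, there is an absolute constant $\varepsilon>0$ such that for every unsatisfiable CNF $F$ every tree-like resolution refutation of $F\circ \mathrm{OR}$ has size at least $2^{\varepsilon\,\mathrm{DT}_1(\mathrm{Search}(F))}$.
   Context: $F\circ\mathrm{OR}$: replace each variable $x$ of $F$ by two new variables $x_1,x_2$; for each clause $C\in F$ include the clauses of the CNF expansion of the expression obtained from $C$ by replacing each positive literal $x$ by $x_1\vee x_2$ and each negative literal $\overline{x}$ by $\overline{x_1}\wedge\overline{x_2}$ (distributing, so $C$ gives one clause for each choice of one of $\overline{x_1},\overline{x_2}$ for every negative literal $\overline{x}$ of $C$). $\mathrm{Search}(F)$ is the relation whose inputs are the assignments $\alpha$ to the variables of $F$ and whose valid outputs on $\alpha$ are the clauses of $F$ falsified by $\alpha$. For a relation $f$, $\mathrm{DT}_1(f)$ is the minimum, over all decision trees computing $f$ (querying one variable at a time and outputting at each leaf a valid output for all inputs reaching it), of the maximum over root-to-leaf paths of the number of queries on the path answered $1$. Tree-like resolution: refutations using the rule "from $C\vee x$ and $D\vee\overline{x}$ infer $C\vee D$" (and optionally weakening) deriving the empty clause, where the underlying derivation graph is a tree; the size is the number of clauses (nodes) in the tree. *)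

theory Defs
  imports Complex_Main "HOL-Library.FuncSet"
begin

section \<open>CNF formulas\<close>

datatype 'v literal = Pos (var: 'v) | Neg (var: 'v)

type_synonym 'v clause = "'v literal set"
type_synonym 'v cnf = "'v clause set"

definition is_cnf :: "'v cnf \<Rightarrow> bool" where
  "is_cnf F \<longleftrightarrow> finite F \<and> (\<forall>C\<in>F. finite C)"

definition vars :: "'v cnf \<Rightarrow> 'v set" where
  "vars F = (\<Union>C\<in>F. var ` C)"

text \<open>An assignment to the variables in \<open>X\<close> takes the value \<^const>\<open>undefined\<close> outside \<open>X\<close>.\<close>

definition assignments :: "'v set \<Rightarrow> ('v \<Rightarrow> bool) set" where
  "assignments X = X \<rightarrow>\<^sub>E UNIV"

fun lit_true :: "('v \<Rightarrow> bool) \<Rightarrow> 'v literal \<Rightarrow> bool" where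
  "lit_true \<alpha> (Pos x) \<longleftrightarrow> \<alpha> x"
| "lit_true \<alpha> (Neg x) \<longleftrightarrow> \<not> \<alpha> x"

definition falsifies :: "('v \<Rightarrow> bool) \<Rightarrow> 'v clause \<Rightarrow> bool" where
  "falsifies \<alpha> C \<longleftrightarrow> (\<forall>l\<in>C. \<not> lit_true \<alpha> l)"

definition satisfies :: "('v \<Rightarrow> bool) \<Rightarrow> 'v cnf \<Rightarrow> bool" where
  "satisfies \<alpha> F \<longleftrightarrow> (\<forall>C\<in>F. \<exists>l\<in>C. lit_true \<alpha> l)"

definition unsatisfiable :: "'v cnf \<Rightarrow> bool" where
  "unsatisfiable F \<longleftrightarrow> (\<forall>\<alpha>\<in>assignments (vars F). \<not> satisfies \<alpha> F)"


section \<open>Composition with OR\<close>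

text \<open>
  The two new variables replacing \<open>x\<close> are \<open>(x, False)\<close> and \<open>(x, True)\<close>. The function \<open>\<sigma>\<close> selects,
  for every negative literal \<open>Neg x\<close> of \<open>C\<close>, one conjunct of the expression substituted for it;
  its values at other variables do not affect the clause.
\<close>

definition or_clause :: "'v clause \<Rightarrow> ('v \<Rightarrow> bool) \<Rightarrow> ('v \<times> bool) clause" where
  "or_clause C \<sigma> = {Pos (x, b) | x b. Pos x \<in> C} \<union> {Neg (x, \<sigma> x) | x. Neg x \<in> C}"

definition compose_or :: "'v cnf \<Rightarrow> ('v \<times> bool) cnf" where
  "compose_or F = {or_clause C \<sigma> | C \<sigma>. C \<in> F}"


section \<open>Decision trees and the search problem\<close>

definition Search :: "'v cnf \<Rightarrow> (('v \<Rightarrow> bool) \<times> 'v clause) set" where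
  "Search F = {(\<alpha>, C). \<alpha> \<in> assignments (vars F) \<and> C \<in> F \<and> falsifies \<alpha> C}"

text \<open>In \<open>Query x T0 T1\<close> the tree continues with \<open>T0\<close> on answer 0 and with \<open>T1\<close> on answer 1.\<close>

datatype ('v, 'o) dtree = Leaf 'o | Query 'v "('v, 'o) dtree" "('v, 'o) dtree"

fun queried :: "('v, 'o) dtree \<Rightarrow> 'v set" where
  "queried (Leaf z) = {}"
| "queried (Query x T0 T1) = insert x (queried T0 \<union> queried T1)"

fun run :: "('v, 'o) dtree \<Rightarrow> ('v \<Rightarrow> bool) \<Rightarrow> 'o" where
  "run (Leaf z) \<alpha> = z"
| "run (Query x T0 T1) \<alpha> = (if \<alpha> x then run T1 \<alpha> else run T0 \<alpha>)"

text \<open>The maximum over root-to-leaf paths of the number of queries answered 1:\<close>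

fun max_ones :: "('v, 'o) dtree \<Rightarrow> nat" where
  "max_ones (Leaf z) = 0"
| "max_ones (Query x T0 T1) = max (max_ones T0) (Suc (max_ones T1))"

definition computes :: "'v set \<Rightarrow> ('v, 'o) dtree \<Rightarrow> (('v \<Rightarrow> bool) \<times> 'o) set \<Rightarrow> bool" where
  "computes X T f \<longleftrightarrow> queried T \<subseteq> X \<and> (\<forall>\<alpha>\<in>assignments X. (\<alpha>, run T \<alpha>) \<in> f)"

text \<open>
  Here \<open>X\<close> is the set of input variables of the relation \<open>f\<close>. On \<^typ>\<open>nat\<close> the infimum of a nonempty
  set is its minimum; \<open>Search_computable\<close> below shows that the set is nonempty for the
  search problem of an unsatisfiable CNF formula.
\<close>

definition DT1 :: "'v set \<Rightarrow> (('v \<Rightarrow> bool) \<times> 'o) set \<Rightarrow> nat" where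
  "DT1 X f = Inf {max_ones T | T. computes X T f}"

lemma run_cong: "(\<And>x. x \<in> queried T \<Longrightarrow> \<alpha> x = \<beta> x) \<Longrightarrow> run T \<alpha> = run T \<beta>"
  by (induction T) auto

lemma total_computable:
  assumes "finite X" and "\<And>\<alpha>. \<alpha> \<in> assignments X \<Longrightarrow> \<exists>z. (\<alpha>, z) \<in> f"
  shows "\<exists>T. computes X T f"
  using assms
proof (induction X arbitrary: f rule: finite_induct)
  case empty
  have "(\<lambda>_. undefined) \<in> assignments ({} :: 'a set)"
    by (simp add: assignments_def)
  with empty obtain z where "((\<lambda>_. undefined), z) \<in> f" by blast
  then have "computes {} (Leaf z) f"
    by (simp add: computes_def assignments_def)
  then show ?case by blast
next
  case (insert x X)
  have "\<exists>T. computes X T {(\<alpha>, z). (\<alpha>(x := b), z) \<in> f}" for b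
  proof (rule insert.IH)
    fix \<alpha> :: "'a \<Rightarrow> bool" assume "\<alpha> \<in> assignments X"
    then have "\<alpha>(x := b) \<in> assignments (insert x X)"
      by (auto simp: assignments_def PiE_def extensional_def)
    then show "\<exists>z. (\<alpha>, z) \<in> {(\<alpha>, z). (\<alpha>(x := b), z) \<in> f}"
      using insert.prems by auto
  qed
  then have "\<forall>b. \<exists>T. computes X T {(\<alpha>, z). (\<alpha>(x := b), z) \<in> f}" by blast
  from choice[OF this] obtain T where T: "computes X (T b) {(\<alpha>, z). (\<alpha>(x := b), z) \<in> f}" for b
    by blast
  have "(\<alpha>, run (T (\<alpha> x)) \<alpha>) \<in> f" if \<alpha>: "\<alpha> \<in> assignments (insert x X)" for \<alpha>
  proof -
    have "\<alpha>(x := undefined) \<in> assignments X"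
      using \<alpha> by (auto simp: assignments_def PiE_def extensional_def)
    then have "(\<alpha>, run (T (\<alpha> x)) (\<alpha>(x := undefined))) \<in> f"
      using T[of "\<alpha> x"] by (auto simp: computes_def)
    moreover have "run (T (\<alpha> x)) (\<alpha>(x := undefined)) = run (T (\<alpha> x)) \<alpha>"
      using T[of "\<alpha> x"] insert.hyps(2) by (intro run_cong) (auto simp: computes_def)
    ultimately show ?thesis by simp
  qed
  moreover have "run (Query x (T False) (T True)) \<alpha> = run (T (\<alpha> x)) \<alpha>" for \<alpha>
    by (cases "\<alpha> x") simp_all
  ultimately have "computes (insert x X) (Query x (T False) (T True)) f"
    using T[of False] T[of True] unfolding computes_def by (simp add: subset_insertI2)
  then show ?case by blast
qed

lemma Search_computable:
  assumes "is_cnf F" and "unsatisfiable F"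
  shows "\<exists>T. computes (vars F) T (Search F)"
proof (rule total_computable)
  show "finite (vars F)"
    using assms(1) by (auto simp: is_cnf_def vars_def)
  show "\<exists>C. (\<alpha>, C) \<in> Search F" if "\<alpha> \<in> assignments (vars F)" for \<alpha>
    using assms(2) that
    by (auto simp: unsatisfiable_def satisfies_def Search_def falsifies_def)
qed


section \<open>Tree-like resolution\<close>

text \<open>Every node carries the clause derived at it; \<open>Res E x P Q\<close> resolves on the variable \<open>x\<close>.\<close>

datatype 'v rtree =
    Axiom "'v clause"
  | Res "'v clause" 'v "'v rtree" "'v rtree"
  | Weaken "'v clause" "'v rtree"

fun conclusion :: "'v rtree \<Rightarrow> 'v clause" where
  "conclusion (Axiom E) = E"
| "conclusion (Res E x P Q) = E"
| "conclusion (Weaken E P) = E"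

text \<open>
  Weakening is allowed, so derivations without it are included. Since clauses are sets, the
  side clauses \<open>C\<close> and \<open>D\<close> of a resolution step may themselves contain the resolved literals.
\<close>

fun derivation :: "'v cnf \<Rightarrow> 'v rtree \<Rightarrow> bool" where
  "derivation F (Axiom E) \<longleftrightarrow> E \<in> F"
| "derivation F (Res E x P Q) \<longleftrightarrow> derivation F P \<and> derivation F Q \<and>
     (\<exists>C D. conclusion P = insert (Pos x) C \<and> conclusion Q = insert (Neg x) D \<and> E = C \<union> D)"
| "derivation F (Weaken E P) \<longleftrightarrow> derivation F P \<and> conclusion P \<subseteq> E \<and> finite E"

definition tree_refutation :: "'v cnf \<Rightarrow> 'v rtree \<Rightarrow> bool" where
  "tree_refutation F P \<longleftrightarrow> derivation F P \<and> conclusion P = {}"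

fun num_nodes :: "'v rtree \<Rightarrow> nat" where
  "num_nodes (Axiom E) = 1"
| "num_nodes (Res E x P Q) = num_nodes P + num_nodes Q + 1"
| "num_nodes (Weaken E P) = num_nodes P + 1"

end

(*
  A tree refutation is walked from the root to an axiom, keeping the current clause falsified by a
  partial assignment to the variables (x, b).  To build a decision tree for Search(F), x is queried
  only when necessary.  When the refutation resolves on (x, b) and (x, not b) is unset, then either
  the answer 0 leads to the smaller subtree and is given without querying x, or x is queried and the
  answer 1 leads to a subtree of at most half the size.  When (x, not b) was already set to 0 for
  free, x is queried and the answer 1 is paid for by the halving at that earlier step.  Hence the
  number of 1-answers is at most the binary logarithm of the size.
*)
theory Submission
  imports Defs
begin

text \<open>
  The knowledge about a variable \<open>x\<close> and its two copies: \<open>Half b\<close> means that \<open>(x, b)\<close> is 0 while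
  \<open>x\<close> has not been queried, and \<open>One b\<close> that \<open>x\<close> is 1, with \<open>(x, b)\<close> being the only copy set to 1.
\<close>

datatype status = Unknown | Half bool | Zero | One bool

fun copy_value :: "status \<Rightarrow> bool \<Rightarrow> bool option" where
  "copy_value Unknown c = None"
| "copy_value (Half b) c = (if c = b then Some False else None)"
| "copy_value Zero c = Some False"
| "copy_value (One b) c = Some (c = b)"

fun lit_falsified :: "('v \<Rightarrow> status) \<Rightarrow> ('v \<times> bool) literal \<Rightarrow> bool" where
  "lit_falsified s (Pos (x, b)) \<longleftrightarrow> copy_value (s x) b = Some False"
| "lit_falsified s (Neg (x, b)) \<longleftrightarrow> copy_value (s x) b = Some True"

definition half_set :: "('v \<Rightarrow> status) \<Rightarrow> 'v set" where
  "half_set s = {x. \<exists>b. s x = Half b}"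

text \<open>The variables that may still be queried. Keeping them inside \<open>vars F\<close> makes
  every query legal and \<open>half_set s\<close> finite.\<close>

definition open_set :: "('v \<Rightarrow> status) \<Rightarrow> 'v set" where
  "open_set s = {x. s x = Unknown} \<union> half_set s"

text \<open>\<open>Half\<close> puts no condition on \<alpha>: with one copy 0, the other copy can
  still give the disjunction either value.\<close>

definition consistent :: "'v set \<Rightarrow> ('v \<Rightarrow> bool) \<Rightarrow> ('v \<Rightarrow> status) \<Rightarrow> bool" where
  "consistent X \<alpha> s \<longleftrightarrow> (\<forall>x\<in>X. (s x = Zero \<longrightarrow> \<not> \<alpha> x) \<and> (\<forall>b. s x = One b \<longrightarrow> \<alpha> x))"

lemma lit_falsified_update:
  assumes "lit_falsified s l" and "\<And>c v. copy_value (s x) c = Some v \<Longrightarrow> copy_value t c = Some v"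
  shows "lit_falsified (s(x := t)) l"
  using assms by (cases "(s, l)" rule: lit_falsified.cases) auto

lemma half_set_Half: "half_set (s(x := Half b)) = insert x (half_set s)"
  by (auto simp: half_set_def)

lemma half_set_closed: "half_set (s(x := Zero)) = half_set s - {x}" "half_set (s(x := One b)) = half_set s - {x}"
  by (auto simp: half_set_def)

lemma open_set_closed: "open_set (s(x := Zero)) \<subseteq> open_set s" "open_set (s(x := One b)) \<subseteq> open_set s"
  by (auto simp: open_set_def half_set_def)

text \<open>A positive literal puts both copies into the clause, and only \<open>Zero\<close> makes
  both 0; a negative one puts in a single negated copy, and only \<open>One\<close> makes a copy
  1.\<close>

lemma falsifies_if_or_clause_falsified:
  assumes "\<forall>l \<in> or_clause C \<sigma>. lit_falsified s l" and "consistent X \<alpha> s" and "var ` C \<subseteq> X"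
  shows "falsifies \<alpha> C"
  unfolding falsifies_def
proof
  fix l assume l: "l \<in> C"
  show "\<not> lit_true \<alpha> l"
  proof (cases l)
    case (Pos x)
    have "Pos (x, b) \<in> or_clause C \<sigma>" for b
      using l Pos by (auto simp: or_clause_def)
    then have "copy_value (s x) b = Some False" for b
      using assms(1) by fastforce
    from this[of True] this[of False] have "s x = Zero"
      by (cases "s x") (auto split: if_splits)
    moreover have "x \<in> X" using l Pos assms(3) by force
    ultimately show ?thesis using Pos assms(2) by (auto simp: consistent_def)
  next
    case (Neg x)
    have "Neg (x, \<sigma> x) \<in> or_clause C \<sigma>"
      using l Neg by (auto simp: or_clause_def)
    then have "copy_value (s x) (\<sigma> x) = Some True"
      using assms(1) by fastforce
    then have "\<exists>b. s x = One b"
      by (cases "s x") (auto split: if_splits)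
    moreover have "x \<in> X" using l Neg assms(3) by force
    ultimately show ?thesis using Neg assms(2) by (auto simp: consistent_def)
  qed
qed

definition solves :: "'v cnf \<Rightarrow> ('v \<Rightarrow> status) \<Rightarrow> ('v, 'v clause) dtree \<Rightarrow> bool" where
  "solves F s T \<longleftrightarrow> queried T \<subseteq> vars F \<and>
     (\<forall>\<alpha>. consistent (vars F) \<alpha> s \<longrightarrow> run T \<alpha> \<in> F \<and> falsifies \<alpha> (run T \<alpha>))"

lemma solves_Query:
  assumes "solves F (s(x := Zero)) T0" and "solves F (s(x := One b)) T1" and "x \<in> vars F"
  shows "solves F s (Query x T0 T1)"
proof -
  have "consistent (vars F) \<alpha> (s(x := One b))" if "consistent (vars F) \<alpha> s" "\<alpha> x" for \<alpha>
    using that by (auto simp: consistent_def)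
  moreover have "consistent (vars F) \<alpha> (s(x := Zero))" if "consistent (vars F) \<alpha> s" "\<not> \<alpha> x" for \<alpha>
    using that by (auto simp: consistent_def)
  ultimately show ?thesis
    using assms by (auto simp: solves_def)
qed

text \<open>Passing to \<open>Half b\<close> excludes no assignment, so the same tree works and no
  query is spent.\<close>

lemma solves_Half:
  assumes "solves F (s(x := Half b)) T" and "s x = Unknown"
  shows "solves F s T"
proof -
  have "consistent (vars F) \<alpha> (s(x := Half b))" if "consistent (vars F) \<alpha> s" for \<alpha>
    using that by (auto simp: consistent_def)
  then show ?thesis
    using assms(1) by (auto simp: solves_def)
qed

text \<open>The weight \<open>2 ^ card (half_set s)\<close> records the halvings that have not yet paid for a 1-answer.\<close>

lemma dtree_of_derivation:
  assumes "finite (vars F)"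
    and "derivation (compose_or F) P"
    and "\<forall>l \<in> conclusion P. lit_falsified s l"
    and "open_set s \<subseteq> vars F"
  shows "\<exists>T. solves F s T \<and> 2 ^ max_ones T \<le> num_nodes P * 2 ^ card (half_set s)"
  using assms(2-)
proof (induction P arbitrary: s)
  case (Axiom E)
  then obtain C \<sigma> where C: "C \<in> F" "E = or_clause C \<sigma>"
    by (auto simp: compose_or_def)
  then have "var ` C \<subseteq> vars F" by (auto simp: vars_def)
  then have "solves F s (Leaf C)"
    using Axiom.prems(2) C by (auto simp: solves_def intro: falsifies_if_or_clause_falsified)
  then show ?case by (intro exI[of _ "Leaf C"]) simp
next
  case (Weaken E P)
  then obtain T where "solves F s T" "2 ^ max_ones T \<le> num_nodes P * 2 ^ card (half_set s)"
    by (metis conclusion.simps(3) derivation.simps(3) subsetD)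
  then show ?case by (intro exI[of _ T]) simp
next
  case (Res E y P Q)
  obtain x b where y: "y = (x, b)" by force
  have der: "derivation (compose_or F) P" "derivation (compose_or F) Q"
    using Res.prems(1) by simp_all
  obtain C D where CD: "conclusion P = insert (Pos (x, b)) C"
      "conclusion Q = insert (Neg (x, b)) D" "E = C \<union> D"
    using Res.prems(1) y by auto
  have E: "\<forall>l\<in>C \<union> D. lit_falsified s l"
    using Res.prems(2) CD by simp
  have fin: "finite (half_set s)"
    using Res.prems(3) assms(1) by (auto simp: open_set_def intro: finite_subset)
  show ?case
  \<comment> \<open>If the resolved copy is already set, one premise is falsified as it stands and
    its tree is reused.\<close>
  proof (cases "copy_value (s x) b")
    case (Some v)
    show ?thesis
    proof (cases v)
      case True
      then have "\<forall>l\<in>conclusion Q. lit_falsified s l" using E CD Some by auto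
      from Res.IH(2)[OF der(2) this Res.prems(3)] obtain T where
        "solves F s T" "2 ^ max_ones T \<le> num_nodes Q * 2 ^ card (half_set s)" by blast
      then show ?thesis by (intro exI[of _ T]) (simp add: algebra_simps)
    next
      case False
      then have "\<forall>l\<in>conclusion P. lit_falsified s l" using E CD Some by auto
      from Res.IH(1)[OF der(1) this Res.prems(3)] obtain T where
        "solves F s T" "2 ^ max_ones T \<le> num_nodes P * 2 ^ card (half_set s)" by blast
      then show ?thesis by (intro exI[of _ T]) (simp add: algebra_simps)
    qed
  next
    case None
    then have status: "s x = Unknown \<or> s x = Half (\<not> b)"
      by (cases "s x") (auto split: if_splits)
    then have x: "x \<in> vars F"
      using Res.prems(3) by (auto simp: open_set_def half_set_def)
    show ?thesis
    \<comment> \<open>The free move to \<open>P\<close>: the size at least halves, which offsets the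
      doubling of the weight by the new element of \<open>half_set\<close>.\<close>
    proof (cases "s x = Unknown \<and> num_nodes P \<le> num_nodes Q")
      case True
      have "lit_falsified (s(x := Half b)) l" if "lit_falsified s l" for l
        using that by (rule lit_falsified_update) (simp add: True)
      then have "\<forall>l\<in>conclusion P. lit_falsified (s(x := Half b)) l"
        using E CD by auto
      moreover have "open_set (s(x := Half b)) \<subseteq> vars F"
        using Res.prems(3) x by (auto simp: open_set_def half_set_def)
      ultimately obtain T where T: "solves F (s(x := Half b)) T"
          "2 ^ max_ones T \<le> num_nodes P * 2 ^ card (half_set (s(x := Half b)))"
        using Res.IH(1)[OF der(1)] by blast
      have "x \<notin> half_set s" using True by (simp add: half_set_def)
      then have "2 ^ max_ones T \<le> (2 * num_nodes P) * 2 ^ card (half_set s)"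
        using T(2) fin by (simp add: half_set_Half)
      also have "\<dots> \<le> num_nodes (Res E y P Q) * 2 ^ card (half_set s)"
        using True by (intro mult_right_mono) simp_all
      finally show ?thesis
        using solves_Half[OF T(1)] True by blast
    next
      case False
      \<comment> \<open>Both answers respect a copy set for free: if \<open>s x\<close> is
        \<open>Half (\<not> b)\<close>, then \<open>One b\<close> also makes the copy
        \<open>(x, \<not> b)\<close> 0.\<close>
      have "lit_falsified (s(x := Zero)) l" "lit_falsified (s(x := One b)) l"
        if "lit_falsified s l" for l
        using status by (auto intro!: lit_falsified_update[OF that] split: if_splits)
      then have falsified: "\<forall>l\<in>conclusion P. lit_falsified (s(x := Zero)) l"
          "\<forall>l\<in>conclusion Q. lit_falsified (s(x := One b)) l"
        using E CD by auto
      obtain T0 where T0: "solves F (s(x := Zero)) T0"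
          "2 ^ max_ones T0 \<le> num_nodes P * 2 ^ card (half_set s - {x})"
        using Res.IH(1)[OF der(1) falsified(1)] open_set_closed(1) Res.prems(3)
        by (metis half_set_closed(1) subset_trans)
      obtain T1 where T1: "solves F (s(x := One b)) T1"
          "2 ^ max_ones T1 \<le> num_nodes Q * 2 ^ card (half_set s - {x})"
        using Res.IH(2)[OF der(2) falsified(2)] open_set_closed(2) Res.prems(3)
        by (metis half_set_closed(2) subset_trans)
      have "2 ^ max_ones T0 \<le> num_nodes P * 2 ^ card (half_set s)"
        using T0(2) by (rule order_trans) (simp add: card_mono fin)
      moreover have "2 ^ Suc (max_ones T1) \<le> num_nodes (Res E y P Q) * 2 ^ card (half_set s)"
      \<comment> \<open>The factor 2 for the answer 1 comes from \<open>Q\<close> being smaller than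
        \<open>P\<close> if \<open>x\<close> is \<open>Unknown\<close>, and otherwise from
        \<open>x\<close> leaving \<open>half_set\<close>.\<close>
      proof (cases "s x = Unknown")
        case True
        then have "half_set s - {x} = half_set s" by (auto simp: half_set_def)
        then have "2 ^ Suc (max_ones T1) \<le> (2 * num_nodes Q) * 2 ^ card (half_set s)"
          using T1(2) by simp
        also have "\<dots> \<le> num_nodes (Res E y P Q) * 2 ^ card (half_set s)"
          using False True by (intro mult_right_mono) simp_all
        finally show ?thesis .
      next
        case False
        then have "x \<in> half_set s" using status by (auto simp: half_set_def)
        then have "card (half_set s) = Suc (card (half_set s - {x}))"
          using fin by (metis card.remove)
        then show ?thesis using T1(2) by (simp add: algebra_simps)
      qed
      ultimately have "2 ^ max_ones (Query x T0 T1) \<le> num_nodes (Res E y P Q) * 2 ^ card (half_set s)"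
        by (simp add: max_def algebra_simps)
      then show ?thesis
        using solves_Query[OF T0(1) T1(1) x] by blast
    qed
  qed
qed

text \<open>At the root \<open>half_set\<close> is empty, so the weight is 1 and the size alone
  bounds the 1-answers.\<close>

lemma two_power_DT1_le_num_nodes:
  assumes "is_cnf F" and "tree_refutation (compose_or F) P"
  shows "2 ^ DT1 (vars F) (Search F) \<le> num_nodes P"
proof -
  \<comment> \<open>\<open>P\<close> may resolve on copies of variables outside \<open>vars F\<close>, which the decision tree must not query.\<close>
  define s where "s x = (if x \<in> vars F then Unknown else Zero)" for x
  have "finite (vars F)" using assms(1) by (auto simp: is_cnf_def vars_def)
  moreover have half: "half_set s = {}" by (auto simp: half_set_def s_def)
  moreover have "open_set s \<subseteq> vars F" using half by (auto simp: open_set_def s_def split: if_splits)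
  ultimately obtain T where T: "solves F s T" "2 ^ max_ones T \<le> num_nodes P"
    using dtree_of_derivation[of F P s] assms(2) by (auto simp: tree_refutation_def)
  have "consistent (vars F) \<alpha> s" for \<alpha> by (simp add: consistent_def s_def)
  then have "computes (vars F) T (Search F)"
    using T(1) by (auto simp: computes_def solves_def Search_def)
  then have "DT1 (vars F) (Search F) \<le> max_ones T"
    unfolding DT1_def by (intro cInf_lower) auto
  then have "(2::nat) ^ DT1 (vars F) (Search F) \<le> 2 ^ max_ones T"
    by (intro power_increasing) auto
  with T(2) show ?thesis by linarith
qed

theorem lemma3p7:
  shows "\<exists>\<epsilon>::real. \<epsilon> > 0 \<and>
    (\<forall>F :: nat cnf. is_cnf F \<longrightarrow> unsatisfiable F \<longrightarrow>
      (\<forall>P. tree_refutation (compose_or F) P \<longrightarrow>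
        real (num_nodes P) \<ge> 2 powr (\<epsilon> * real (DT1 (vars F) (Search F)))))"
proof (intro exI[of _ 1] conjI allI impI)
  fix F :: "nat cnf" and P
  assume "is_cnf F" "tree_refutation (compose_or F) P"
  then have "2 ^ DT1 (vars F) (Search F) \<le> num_nodes P"
    by (rule two_power_DT1_le_num_nodes)
  then have "(2::real) ^ DT1 (vars F) (Search F) \<le> real (num_nodes P)"
    by (metis of_nat_le_iff of_nat_numeral of_nat_power)
  then show "2 powr (1 * real (DT1 (vars F) (Search F))) \<le> real (num_nodes P)"
    by (simp add: powr_realpow)
qed simp

end
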